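(* Let $d$ be an IL proof tree with conclusion $[P]\,\mathsf{r}\,[Q]$ and let $Q'$ be an assertion with $\text{false}\not\equiv Q'\implies Q$. Let $P'=\mathrm{UTurn}(d,Q')$. Then the U-Turn judgment $d\vdash\langle P'\rangle\,\mathsf{r}\,\langle Q'\rangle$ is derivable.
   Context: Language: atomic commands $\mathsf{c} ::= \mathtt{skip}\mid x:=a\mid b?\mid x:=\mathtt{nondet()}$; regular commands $\mathsf{r}::=\mathsf{c}\mid\mathsf{r};\mathsf{r}\mid\mathsf{r}\boxplus\mathsf{r}\mid\mathsf{r}^*$. States are pairs of a flag in $\{ok,er\}$ and a store $\sigma:\mathrm{Var}\to\mathbb{Z}$. Assertions are sets of states; $\land,\lor,\implies,\text{false}$ are intersection, union, inclusion, $\varnothing$. For a set of stores $P$: $ok{:}P$ (resp. $er{:}P$) is the set of ok- (resp. er-)tagged states with store in $P$; $P[a/x]=\{\sigma\mid\sigma[x\mapsto[\![a]\!]\sigma]\in P\}$; $\exists x.P=\{\sigma[x\mapsto v]\mid\sigma\in P,v\in\mathbb{Z}\}$; $\mathrm{sp}_{x:=a}(P)=\{\sigma[x\mapsto[\![a]\!]\sigma]\mid\sigma\in P\}$. IL proof trees are built from: (assign) $[ok{:}P]\,x:=a\,[ok{:}\mathrm{sp}_{x:=a}(P)]$; (assume) $[ok{:}P]\,b?\,[ok{:}P\land b]$; (nondet) $[ok{:}P]\,x:=\mathtt{nondet()}\,[ok{:}\exists x.P]$; (skip) $[ok{:}P]\,\mathtt{skip}\,[ok{:}P]$; (er-id)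 $[er{:}P]\,\mathsf{r}\,[er{:}P]$; (disj) from $[P_1]\mathsf{r}[Q_1]$, $[P_2]\mathsf{r}[Q_2]$ infer $[P_1\lor P_2]\mathsf{r}[Q_1\lor Q_2]$; (cons) from $[P']\mathsf{r}[Q']$ with $P'\implies P$, $Q\implies Q'$ infer $[P]\mathsf{r}[Q]$; (seq) from $[P]\mathsf{r}_1[R]$, $[R]\mathsf{r}_2[Q]$ infer $[P]\mathsf{r}_1;\mathsf{r}_2[Q]$; (choiceL/R) from $[P]\mathsf{r}_i[Q]$ infer $[P]\mathsf{r}_1\boxplus\mathsf{r}_2[Q]$; (iter0) $[P]\mathsf{r}^*[P]$; (unroll) from $[P]\mathsf{r}^*;\mathsf{r}[Q]$ infer $[P]\mathsf{r}^*[Q]$. U-Turn judgments $d\vdash\langle P'\rangle\mathsf{r}\langle Q'\rangle$ ($d$ an IL proof tree concluding some $[P]\mathsf{r}[Q]$) are derived by the rules: (assign) if $d$ is the axiom $[ok{:}P]x:=a[ok{:}\mathrm{sp}_{x:=a}(P)]$ and $Q'\implies\mathrm{sp}_{x:=a}(P)$, then $d\vdash\langle ok{:}P\land Q'[a/x]\rangle x:=a\langle ok{:}Q'\rangle$; (nondet) if $d$ is the axiom $[ok{:}P]x:=\mathtt{nondet()}[ok{:}\exists x.P]$ and $Q'\implies\exists x.P$, then $d\vdash\langle ok{:}P\land\exists x.Q'\rangle x:=\mathtt{nondet()}\langle ok{:}Q'\rangle$; (assume) if $d$ is the axiom $[ok{:}P]b?[ok{:}P\land b]$ and $Q'\implies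 P\land b$, then $d\vdash\langle ok{:}Q'\rangle b?\langle ok{:}Q'\rangle$; (skip) if $d$ is the skip axiom with pre/post $P$ and $Q'\implies P$, then $d\vdash\langle Q'\rangle\mathtt{skip}\langle Q'\rangle$; (er-id) if $d$ is $[er{:}P]\mathsf{r}[er{:}P]$ and $Q'\implies P$, then $d\vdash\langle er{:}Q'\rangle\mathsf{r}\langle er{:}Q'\rangle$; (empty) for any $d$, $d\vdash\langle\text{false}\rangle\mathsf{r}\langle\text{false}\rangle$; (disj) if $d$ ends with IL (disj) with subtrees $d_1,d_2$ and $d_i\vdash\langle P_i'\rangle\mathsf{r}\langle Q_i'\rangle$, then $d\vdash\langle P_1'\lor P_2'\rangle\mathsf{r}\langle Q_1'\lor Q_2'\rangle$; (seq) if $d$ ends with IL (seq) with subtrees $d_1,d_2$ and $d_1\vdash\langle P'\rangle\mathsf{r}_1\langle R'\rangle$, $d_2\vdash\langle R'\rangle\mathsf{r}_2\langle Q'\rangle$, then $d\vdash\langle P'\rangle\mathsf{r}_1;\mathsf{r}_2\langle Q'\rangle$; (choiceL/R) if $d$ ends with IL (choiceL)/(choiceR) with subtree $d'$ and $d'\vdash\langle P'\rangle\mathsf{r}_i\langle Q'\rangle$, then $d\vdash\langle P'\rangle\mathsf{r}_1\boxplus\mathsf{r}_2\langle Q'\rangle$; (iter0) if $d$ is $[P]\mathsf{r}^*[P]$ and $Q'\implies P$, then $d\vdash\langle Q'\rangle\mathsf{r}^*\langle Q'\rangle$; (unroll) if $d$ ends with IL (unroll) with subtree $d'$ and $d'\vdash\langle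 P'\rangle\mathsf{r}^*;\mathsf{r}\langle Q'\rangle$, then $d\vdash\langle P'\rangle\mathsf{r}^*\langle Q'\rangle$; (consIL) if $d$ ends with IL (cons) concluding $[P]\mathsf{r}[Q]$ from subtree $d'$, $d'\vdash\langle P''\rangle\mathsf{r}\langle Q''\rangle$ and $Q''\implies Q$, then $d\vdash\langle P''\rangle\mathsf{r}\langle Q''\rangle$; (consSIL) if $d$ concludes $[P]\mathsf{r}[Q]$, $d\vdash\langle P''\rangle\mathsf{r}\langle Q''\rangle$, $\text{false}\not\equiv P'\implies P''$ and $Q''\implies Q'\implies Q$, then $d\vdash\langle P'\rangle\mathsf{r}\langle Q'\rangle$. The function $\mathrm{UTurn}(d,Q')$ is defined by recursion on $d$ according to its last rule: (assign) with pre $ok{:}P$: returns $ok{:}(P\land Q_0[a/x])$ where $Q'=ok{:}Q_0$; (assume): returns $Q'$; (nondet) with pre $ok{:}P$: returns $ok{:}(P\land\exists x.Q_0)$ where $Q'=ok{:}Q_0$; (skip): $Q'$; (seq) with subtrees $d_1,d_2$: $\mathrm{UTurn}(d_1,\mathrm{UTurn}(d_2,Q'))$; (er-id): $Q'$; (choiceL), (choiceR), (unroll) with subtree $d'$: $\mathrm{UTurn}(d',Q')$; (iter0): $Q'$; (cons) with subtree $d'$: $\mathrm{UTurn}(d',Q')$; (disj) with subtrees $d_1,d_2$ concluding $[P_i]\mathsf{r}[Q_i]$: let $Q_i'=Q'\land Q_i$, $P_i'=\text{false}$ if $Q_i'\equiv\text{false}$ and $P_i'=\mathrm{UTurn}(d_i,Q_i')$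 otherwise; return $P_1'\lor P_2'$. *)

theory Defs imports Main begin

text \<open>The concrete syntax of arithmetic and boolean expressions is left open: \<open>'a\<close> and \<open>'b\<close> are
  arbitrary types of expressions, interpreted by denotation functions \<open>av\<close> and \<open>bv\<close> that are
  parameters of everything below. \<open>'v\<close> is the type of program variables.\<close>

type_synonym 'v store = "'v \<Rightarrow> int"

datatype flag = Ok | Er

type_synonym 'v state = "flag \<times> 'v store"

type_synonym 'v assertion = "'v state set"

datatype ('v, 'a, 'b) atom =
    Skip
  | Assign 'v 'a
  | Assume 'b
  | Nondet 'v

datatype ('v, 'a, 'b) com =
    Atom "('v, 'a, 'b) atom"
  | Seq "('v, 'a, 'b) com" "('v, 'a, 'b) com"
  | Choice "('v, 'a, 'b) com" "('v, 'a, 'b) com"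
  | Star "('v, 'a, 'b) com"

definition ok :: "'v store set \<Rightarrow> 'v assertion" where
  "ok P = {(Ok, \<sigma>) | \<sigma>. \<sigma> \<in> P}"

definition er :: "'v store set \<Rightarrow> 'v assertion" where
  "er P = {(Er, \<sigma>) | \<sigma>. \<sigma> \<in> P}"

definition subst :: "('a \<Rightarrow> 'v store \<Rightarrow> int) \<Rightarrow> 'v store set \<Rightarrow> 'a \<Rightarrow> 'v \<Rightarrow> 'v store set" where
  "subst av P a x = {\<sigma>. \<sigma>(x := av a \<sigma>) \<in> P}"

definition ex_var :: "'v \<Rightarrow> 'v store set \<Rightarrow> 'v store set" where
  "ex_var x P = {\<sigma>(x := v) | \<sigma> v. \<sigma> \<in> P}"

definition sp_assign :: "('a \<Rightarrow> 'v store \<Rightarrow> int) \<Rightarrow> 'v \<Rightarrow> 'a \<Rightarrow> 'v store set \<Rightarrow> 'v store set" where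
  "sp_assign av x a P = {\<sigma>(x := av a \<sigma>) | \<sigma>. \<sigma> \<in> P}"

definition sat :: "('b \<Rightarrow> 'v store \<Rightarrow> bool) \<Rightarrow> 'b \<Rightarrow> 'v store set" where
  "sat bv b = {\<sigma>. bv b \<sigma>}"

text \<open>Trees are labelled by the last rule and by the data that the subtrees do not determine;
  \<open>il_proof av bv d P r Q\<close> states that \<open>d\<close> is a well-formed IL proof tree with conclusion
  \<open>[P] r [Q]\<close>.\<close>

datatype ('v, 'a, 'b) tree =
    TAssign 'v 'a "'v store set"
  | TAssume 'b "'v store set"
  | TNondet 'v "'v store set"
  | TSkip "'v store set"
  | TErId "('v, 'a, 'b) com" "'v store set"
  | TDisj "('v, 'a, 'b) tree" "('v, 'a, 'b) tree"
  | TCons "'v assertion" "('v, 'a, 'b) tree" "'v assertion"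
  | TSeq "('v, 'a, 'b) tree" "('v, 'a, 'b) tree"
  | TChoiceL "('v, 'a, 'b) tree" "('v, 'a, 'b) com"
  | TChoiceR "('v, 'a, 'b) com" "('v, 'a, 'b) tree"
  | TIter0 "('v, 'a, 'b) com" "'v assertion"
  | TUnroll "('v, 'a, 'b) tree"

inductive il_proof ::
  "('a \<Rightarrow> 'v store \<Rightarrow> int) \<Rightarrow> ('b \<Rightarrow> 'v store \<Rightarrow> bool) \<Rightarrow> ('v, 'a, 'b) tree \<Rightarrow>
   'v assertion \<Rightarrow> ('v, 'a, 'b) com \<Rightarrow> 'v assertion \<Rightarrow> bool"
  for av :: "'a \<Rightarrow> 'v store \<Rightarrow> int" and bv :: "'b \<Rightarrow> 'v store \<Rightarrow> bool"
where
  il_assign: "il_proof av bv (TAssign x a P) (ok P) (Atom (Assign x a)) (ok (sp_assign av x a P))"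
| il_assume: "il_proof av bv (TAssume b P) (ok P) (Atom (Assume b)) (ok (P \<inter> sat bv b))"
| il_nondet: "il_proof av bv (TNondet x P) (ok P) (Atom (Nondet x)) (ok (ex_var x P))"
| il_skip: "il_proof av bv (TSkip P) (ok P) (Atom Skip) (ok P)"
| il_er_id: "il_proof av bv (TErId r P) (er P) r (er P)"
| il_disj: "il_proof av bv d1 P1 r Q1 \<Longrightarrow> il_proof av bv d2 P2 r Q2 \<Longrightarrow>
    il_proof av bv (TDisj d1 d2) (P1 \<union> P2) r (Q1 \<union> Q2)"
| il_cons: "il_proof av bv d P' r Q' \<Longrightarrow> P' \<subseteq> P \<Longrightarrow> Q \<subseteq> Q' \<Longrightarrow>
    il_proof av bv (TCons P d Q) P r Q"
| il_seq: "il_proof av bv d1 P r1 R \<Longrightarrow> il_proof av bv d2 R r2 Q \<Longrightarrow>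
    il_proof av bv (TSeq d1 d2) P (Seq r1 r2) Q"
| il_choiceL: "il_proof av bv d P r1 Q \<Longrightarrow>
    il_proof av bv (TChoiceL d r2) P (Choice r1 r2) Q"
| il_choiceR: "il_proof av bv d P r2 Q \<Longrightarrow>
    il_proof av bv (TChoiceR r1 d) P (Choice r1 r2) Q"
| il_iter0: "il_proof av bv (TIter0 r P) P (Star r) P"
| il_unroll: "il_proof av bv d P (Seq (Star r) r) Q \<Longrightarrow>
    il_proof av bv (TUnroll d) P (Star r) Q"

primrec post ::
  "('a \<Rightarrow> 'v store \<Rightarrow> int) \<Rightarrow> ('b \<Rightarrow> 'v store \<Rightarrow> bool) \<Rightarrow> ('v, 'a, 'b) tree \<Rightarrow> 'v assertion"
where
  "post av bv (TAssign x a P) = ok (sp_assign av x a P)"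
| "post av bv (TAssume b P) = ok (P \<inter> sat bv b)"
| "post av bv (TNondet x P) = ok (ex_var x P)"
| "post av bv (TSkip P) = ok P"
| "post av bv (TErId r P) = er P"
| "post av bv (TDisj d1 d2) = post av bv d1 \<union> post av bv d2"
| "post av bv (TCons P d Q) = Q"
| "post av bv (TSeq d1 d2) = post av bv d2"
| "post av bv (TChoiceL d r2) = post av bv d"
| "post av bv (TChoiceR r1 d) = post av bv d"
| "post av bv (TIter0 r P) = P"
| "post av bv (TUnroll d) = post av bv d"

lemma il_proof_post: "il_proof av bv d P r Q \<Longrightarrow> post av bv d = Q"
  by (induction rule: il_proof.induct) auto

text \<open>The premises \<open>il_proof av bv d P r Q\<close> ensure that the judgment only relates a well-formed
  IL proof tree \<open>d\<close> to the command \<open>r\<close> of its own conclusion.\<close>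

inductive uturn_judgment ::
  "('a \<Rightarrow> 'v store \<Rightarrow> int) \<Rightarrow> ('b \<Rightarrow> 'v store \<Rightarrow> bool) \<Rightarrow> ('v, 'a, 'b) tree \<Rightarrow>
   'v assertion \<Rightarrow> ('v, 'a, 'b) com \<Rightarrow> 'v assertion \<Rightarrow> bool"
  for av :: "'a \<Rightarrow> 'v store \<Rightarrow> int" and bv :: "'b \<Rightarrow> 'v store \<Rightarrow> bool"
where
  ut_assign: "Q' \<subseteq> sp_assign av x a P \<Longrightarrow>
    uturn_judgment av bv (TAssign x a P)
      (ok (P \<inter> subst av Q' a x)) (Atom (Assign x a)) (ok Q')"
| ut_nondet: "Q' \<subseteq> ex_var x P \<Longrightarrow>
    uturn_judgment av bv (TNondet x P) (ok (P \<inter> ex_var x Q')) (Atom (Nondet x)) (ok Q')"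
| ut_assume: "Q' \<subseteq> P \<inter> sat bv b \<Longrightarrow>
    uturn_judgment av bv (TAssume b P) (ok Q') (Atom (Assume b)) (ok Q')"
| ut_skip: "Q' \<subseteq> ok P \<Longrightarrow> uturn_judgment av bv (TSkip P) Q' (Atom Skip) Q'"
| ut_er_id: "Q' \<subseteq> P \<Longrightarrow> uturn_judgment av bv (TErId r P) (er Q') r (er Q')"
| ut_empty: "il_proof av bv d P r Q \<Longrightarrow> uturn_judgment av bv d {} r {}"
| ut_disj: "il_proof av bv (TDisj d1 d2) P r Q \<Longrightarrow>
    uturn_judgment av bv d1 P1' r Q1' \<Longrightarrow> uturn_judgment av bv d2 P2' r Q2' \<Longrightarrow>
    uturn_judgment av bv (TDisj d1 d2) (P1' \<union> P2') r (Q1' \<union> Q2')"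
| ut_seq: "il_proof av bv (TSeq d1 d2) P (Seq r1 r2) Q \<Longrightarrow>
    uturn_judgment av bv d1 P' r1 R' \<Longrightarrow> uturn_judgment av bv d2 R' r2 Q' \<Longrightarrow>
    uturn_judgment av bv (TSeq d1 d2) P' (Seq r1 r2) Q'"
| ut_choiceL: "il_proof av bv (TChoiceL d r2) P (Choice r1 r2) Q \<Longrightarrow>
    uturn_judgment av bv d P' r1 Q' \<Longrightarrow>
    uturn_judgment av bv (TChoiceL d r2) P' (Choice r1 r2) Q'"
| ut_choiceR: "il_proof av bv (TChoiceR r1 d) P (Choice r1 r2) Q \<Longrightarrow>
    uturn_judgment av bv d P' r2 Q' \<Longrightarrow>
    uturn_judgment av bv (TChoiceR r1 d) P' (Choice r1 r2) Q'"
| ut_iter0: "Q' \<subseteq> P \<Longrightarrow> uturn_judgment av bv (TIter0 r P) Q' (Star r) Q'"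
| ut_unroll: "il_proof av bv (TUnroll d) P (Star r) Q \<Longrightarrow>
    uturn_judgment av bv d P' (Seq (Star r) r) Q' \<Longrightarrow>
    uturn_judgment av bv (TUnroll d) P' (Star r) Q'"
| ut_consIL: "il_proof av bv (TCons P d Q) P r Q \<Longrightarrow>
    uturn_judgment av bv d P'' r Q'' \<Longrightarrow> Q'' \<subseteq> Q \<Longrightarrow>
    uturn_judgment av bv (TCons P d Q) P'' r Q''"
| ut_consSIL: "il_proof av bv d P r Q \<Longrightarrow> uturn_judgment av bv d P'' r Q'' \<Longrightarrow>
    P' \<noteq> {} \<Longrightarrow> P' \<subseteq> P'' \<Longrightarrow> Q'' \<subseteq> Q' \<Longrightarrow> Q' \<subseteq> Q \<Longrightarrow>
    uturn_judgment av bv d P' r Q'"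

text \<open>If \<open>Q' = ok Q0\<close> then \<open>ok_part Q' = Q0\<close>. Below, the clauses for assignment and nondet are only
  meaningful for such \<open>Q'\<close>; this form is guaranteed whenever \<open>Q'\<close> implies the postcondition of
  the tree.\<close>

definition ok_part :: "'v assertion \<Rightarrow> 'v store set" where
  "ok_part Q' = {\<sigma>. (Ok, \<sigma>) \<in> Q'}"

lemma ok_part_ok: "ok_part (ok Q0) = Q0"
  by (auto simp: ok_part_def ok_def)

primrec UTurn ::
  "('a \<Rightarrow> 'v store \<Rightarrow> int) \<Rightarrow> ('b \<Rightarrow> 'v store \<Rightarrow> bool) \<Rightarrow> ('v, 'a, 'b) tree \<Rightarrow>
   'v assertion \<Rightarrow> 'v assertion"
where
  "UTurn av bv (TAssign x a P) Q' = ok (P \<inter> subst av (ok_part Q') a x)"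
| "UTurn av bv (TAssume b P) Q' = Q'"
| "UTurn av bv (TNondet x P) Q' = ok (P \<inter> ex_var x (ok_part Q'))"
| "UTurn av bv (TSkip P) Q' = Q'"
| "UTurn av bv (TErId r P) Q' = Q'"
| "UTurn av bv (TDisj d1 d2) Q' =
    (let Q1' = Q' \<inter> post av bv d1; Q2' = Q' \<inter> post av bv d2;
         P1' = (if Q1' = {} then {} else UTurn av bv d1 Q1');
         P2' = (if Q2' = {} then {} else UTurn av bv d2 Q2')
     in P1' \<union> P2')"
| "UTurn av bv (TCons P d Q) Q' = UTurn av bv d Q'"
| "UTurn av bv (TSeq d1 d2) Q' = UTurn av bv d1 (UTurn av bv d2 Q')"
| "UTurn av bv (TChoiceL d r2) Q' = UTurn av bv d Q'"
| "UTurn av bv (TChoiceR r1 d) Q' = UTurn av bv d Q'"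
| "UTurn av bv (TIter0 r P) Q' = Q'"
| "UTurn av bv (TUnroll d) Q' = UTurn av bv d Q'"

end

theory Submission imports Defs begin

text \<open>Induction on the proof tree. The intermediate assertion passed on at a sequential composition
  again implies the postcondition of the first subtree because \<open>UTurn\<close> never leaves the
  precondition of the tree, and at a disjunction a branch that \<open>Q'\<close> misses is closed by the
  rule (empty).\<close>

text \<open>\<open>ok_part\<close> discards error states, so only assertions below some
  \<open>ok P\<close> are recovered from it; this puts \<open>Q'\<close> in the shape required by
  the assignment, nondet and assume rules.\<close>

lemma subset_ok_eq: "Q' \<subseteq> ok P \<Longrightarrow> Q' = ok (ok_part Q')"
  by (auto simp: ok_def ok_part_def)

lemma subset_er_eq: "Q' \<subseteq> er P \<Longrightarrow> \<exists>Q0. Q' = er Q0 \<and> Q0 \<subseteq> P"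
  by (rule exI[of _ "{\<sigma>. (Er, \<sigma>) \<in> Q'}"]) (auto simp: er_def)

lemma ok_part_mono: "Q' \<subseteq> ok P \<Longrightarrow> ok_part Q' \<subseteq> P"
  by (auto simp: ok_def ok_part_def)

text \<open>Leaves returning \<open>Q'\<close> unchanged have a postcondition inside their
  precondition; assignment and nondet intersect with \<open>P\<close> explicitly; consequence only
  enlarges the precondition.\<close>

lemma UTurn_subset_pre:
  assumes "il_proof av bv d P r Q" and "Q' \<subseteq> Q"
  shows "UTurn av bv d Q' \<subseteq> P"
  using assms
proof (induction arbitrary: Q' rule: il_proof.induct)
  case (il_disj d1 P1 r Q1 d2 P2 Q2)
  have "UTurn av bv d1 (Q' \<inter> Q1) \<subseteq> P1" "UTurn av bv d2 (Q' \<inter> Q2) \<subseteq> P2"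
    using il_disj.IH by simp_all
  then show ?case
    using il_disj.hyps[THEN il_proof_post] by (auto simp: Let_def)
next
  case (il_cons d P' r Q' P Q)
  then show ?case by (metis UTurn.simps(7) order_trans)
qed (auto simp: ok_def)

text \<open>Ranging over all subsets of \<open>Q\<close>, empty or not, lets the induction
  hypothesis for \<open>d1\<close> apply to \<open>UTurn av bv d2 Q'\<close> as soon as that set
  lies in \<open>R\<close>.\<close>

lemma uturn_judgment_UTurn:
  assumes "il_proof av bv d P r Q" and "Q' \<subseteq> Q"
  shows "uturn_judgment av bv d (UTurn av bv d Q') r Q'"
  using assms
proof (induction arbitrary: Q' rule: il_proof.induct)
  case (il_assign x a P)
  then show ?case
    using ut_assign[OF ok_part_mono] subset_ok_eq by (metis UTurn.simps(1))
next
  case (il_assume b P)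
  then show ?case
    using ut_assume[OF ok_part_mono] subset_ok_eq by (metis UTurn.simps(2))
next
  case (il_nondet x P)
  then show ?case
    using ut_nondet[OF ok_part_mono] subset_ok_eq by (metis UTurn.simps(3))
next
  case (il_skip P)
  then show ?case by (simp add: ut_skip)
next
  case (il_er_id r P)
  then show ?case using subset_er_eq ut_er_id by (metis UTurn.simps(5))
next
  case (il_disj d1 P1 r Q1 d2 P2 Q2)
  \<comment> \<open>One generic subtree serves both sides; the conditional copies that of
    \<open>UTurn\<close>, so \<open>ut_disj\<close> produces exactly its value.\<close>
  have branch: "uturn_judgment av bv di
      (if Q' \<inter> Qi = {} then {} else UTurn av bv di (Q' \<inter> Qi)) r (Q' \<inter> Qi)"
    if "il_proof av bv di Pi r Qi" and
      "\<And>Q'. Q' \<subseteq> Qi \<Longrightarrow> uturn_judgment av bv di (UTurn av bv di Q') r Q'" for di Pi Qi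
    using that by (simp add: ut_empty)
  \<comment> \<open>Since \<open>Q'\<close> lies in \<open>Q1 \<union> Q2\<close>, the two pieces
    lose nothing.\<close>
  have "Q' \<inter> Q1 \<union> Q' \<inter> Q2 = Q'"
    using il_disj.prems by blast
  then show ?case
    using ut_disj[OF il_proof.il_disj[OF il_disj.hyps]
        branch[OF il_disj.hyps(1) il_disj.IH(1)] branch[OF il_disj.hyps(2) il_disj.IH(2)]]
      il_disj.hyps[THEN il_proof_post]
    by (simp add: Let_def)
next
  case (il_cons d P' r Q0 P Q)
  \<comment> \<open>The induction hypothesis applies because
    \<open>Q' \<subseteq> Q \<subseteq> Q0\<close>.\<close>
  have "uturn_judgment av bv d (UTurn av bv d Q') r Q'"
    using il_cons by blast
  then show ?case
    using ut_consIL[OF il_proof.il_cons[OF il_cons.hyps]] il_cons.prems by simp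
next
  case (il_seq d1 P r1 R d2 r2 Q)
  then show ?case
    using ut_seq[OF il_proof.il_seq[OF il_seq.hyps]] UTurn_subset_pre by (metis UTurn.simps(8))
next
  case (il_choiceL d P r1 Q r2)
  then show ?case
    using ut_choiceL[OF il_proof.il_choiceL[OF il_choiceL.hyps]] by simp
next
  case (il_choiceR d P r2 Q r1)
  then show ?case
    using ut_choiceR[OF il_proof.il_choiceR[OF il_choiceR.hyps]] by simp
next
  case (il_iter0 r P)
  then show ?case by (simp add: ut_iter0)
next
  case (il_unroll d P r Q)
  then show ?case
    using ut_unroll[OF il_proof.il_unroll[OF il_unroll.hyps]] by simp
qed

theorem theorem4p5:
  fixes av :: "'a \<Rightarrow> 'v store \<Rightarrow> int" and bv :: "'b \<Rightarrow> 'v store \<Rightarrow> bool"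
    and d :: "('v, 'a, 'b) tree" and r :: "('v, 'a, 'b) com"
    and P Q P' Q' :: "'v assertion"
  assumes "il_proof av bv d P r Q"
    and "Q' \<noteq> {}" and "Q' \<subseteq> Q"
    and "P' = UTurn av bv d Q'"
  shows "uturn_judgment av bv d P' r Q'"
  using assms uturn_judgment_UTurn by blast

end
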